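(* There are absolute constants $c_1,c_2,c_3,\epsilon_0>0$ such that for every $\epsilon\in(0,\epsilon_0)$ there exist $n\ge 1$ and a threshold function $f:\{-1,1\}^n\to\{-1,1\}$ with $c_1\le \mathrm{Inf}(f)\le c_2$ such that every function $g:\{-1,1\}^n\to\{-1,1\}$ with $\Pr_x[f(x)\neq g(x)]\le\epsilon$ ($x$ uniform over $\{-1,1\}^n$) depends on at least $c_3/\epsilon^2$ of its variables.
   Context: A threshold function is a function $f:\{-1,1\}^n\to\{-1,1\}$ of the form $f(x)=\mathrm{sign}(w\cdot x-\theta)$ with arbitrary real weights $w_1,\dots,w_n$ and real threshold $\theta$; here $\mathrm{sign}(t)=1$ for $t\ge 0$ and $-1$ for $t<0$. The influence of coordinate $i$ on $f$ is $\mathrm{Inf}_i(f)=\Pr_x[f(x)\ne f(x^{\oplus i})]$, where $x$ is uniform on $\{-1,1\}^n$ and $x^{\oplus i}$ is $x$ with the $i$-th coordinate flipped; the total influence is $\mathrm{Inf}(f)=\sum_{i=1}^n \mathrm{Inf}_i(f)$. *)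

theory Defs
  imports "HOL-Probability.Probability"
begin

text \<open>
  Since the dimension is existentially quantified, points of the discrete cube are functions
  on the index set \<open>{..<n}\<close>, extensional (\<open>undefined\<close>) elsewhere, so that the cube is a finite
  set with \<open>2 ^ n\<close> elements. Functions on the cube are HOL functions on \<open>nat \<Rightarrow> real\<close> of which
  only the values on the cube are ever used.
\<close>

definition cube :: "nat \<Rightarrow> (nat \<Rightarrow> real) set" where
  "cube n = ({..<n} \<rightarrow>\<^sub>E {-1, 1})"

definition cube_prob :: "nat \<Rightarrow> ((nat \<Rightarrow> real) \<Rightarrow> bool) \<Rightarrow> real" where
  "cube_prob n P = measure_pmf.prob (pmf_of_set (cube n)) {x. P x}"

definition flip :: "nat \<Rightarrow> (nat \<Rightarrow> real) \<Rightarrow> (nat \<Rightarrow> real)" where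
  "flip i x = x(i := - x i)"

text \<open>Unlike \<^const>\<open>sgn\<close>, this sign function takes the value 1 at 0.\<close>

definition sign_ge0 :: "real \<Rightarrow> real" where
  "sign_ge0 t = (if t \<ge> 0 then 1 else -1)"

definition threshold_function :: "nat \<Rightarrow> ((nat \<Rightarrow> real) \<Rightarrow> real) \<Rightarrow> bool" where
  "threshold_function n f \<longleftrightarrow>
     (\<exists>(w :: nat \<Rightarrow> real) (\<theta> :: real).
        \<forall>x\<in>cube n. f x = sign_ge0 ((\<Sum>i<n. w i * x i) - \<theta>))"

definition influence :: "nat \<Rightarrow> nat \<Rightarrow> ((nat \<Rightarrow> real) \<Rightarrow> real) \<Rightarrow> real" where
  "influence n i f = cube_prob n (\<lambda>x. f x \<noteq> f (flip i x))"

definition total_influence :: "nat \<Rightarrow> ((nat \<Rightarrow> real) \<Rightarrow> real) \<Rightarrow> real" where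
  "total_influence n f = (\<Sum>i<n. influence n i f)"

definition relevant_variables :: "nat \<Rightarrow> ((nat \<Rightarrow> real) \<Rightarrow> real) \<Rightarrow> nat set" where
  "relevant_variables n g = {i. i < n \<and> (\<exists>x\<in>cube n. g x \<noteq> g (flip i x))}"

end

theory Submission
  imports Defs
begin

text \<open>
  Take \<open>f\<close> to be the conjunction of \<open>k\<close> bits with the majority of \<open>m = 4 ^ k\<close> further bits, where
  \<open>1 / 2 ^ k\<close> lies between \<open>16 \<epsilon>\<close> and \<open>32 \<epsilon>\<close>. Each majority bit has influence
  \<open>(m choose (m div 2)) / 2 ^ (m + k)\<close>, which is of order \<open>1 / (2 ^ k * sqrt m) = 1 / m\<close>, so that
  the total influence is of constant order. Let \<open>T\<close> be the set of majority bits that \<open>g\<close> ignores, and let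
  \<open>A\<close> be the subcube on which the conjunction holds. The correlation of \<open>f - g\<close> with \<open>\<Sum>i\<in>T. x i\<close>
  on \<open>A\<close> is the sum of the influences over \<open>T\<close>, because \<open>g\<close> contributes nothing;
  by Cauchy--Schwarz it is at most \<open>2 * sqrt (\<epsilon> * card T / 2 ^ k)\<close>. Hence \<open>card T \<le> m / 2\<close>.
\<close>

section \<open>Counting in the cube\<close>

lemma finite_cube [simp]: "finite (cube n)"
  by (simp add: cube_def finite_PiE)

lemma card_cube: "card (cube n) = 2 ^ n"
  by (simp add: cube_def card_PiE numeral_2_eq_2)

lemma cube_nonempty: "cube n \<noteq> {}"
  using card_cube[of n] by force

lemma cube_prob_eq: "cube_prob n P = real (card {x \<in> cube n. P x}) / 2 ^ n"
  by (simp add: cube_prob_def measure_pmf_of_set cube_nonempty card_cube Int_def)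

lemma cube_values: "x \<in> cube n \<Longrightarrow> i < n \<Longrightarrow> x i = 1 \<or> x i = -1"
  by (auto simp: cube_def PiE_def Pi_def)

lemma flip_in_cube: "x \<in> cube n \<Longrightarrow> i < n \<Longrightarrow> flip i x \<in> cube n"
  by (auto simp: cube_def flip_def PiE_def Pi_def extensional_def)

lemma flip_apply: "flip i x j = (if j = i then - x i else x j)"
  by (simp add: flip_def)

lemma flip_flip [simp]: "flip i (flip i x) = x"
  by (auto simp: flip_def)

lemma bij_betw_flip: "i < n \<Longrightarrow> bij_betw (flip i) (cube n) (cube n)"
  by (rule bij_betw_byWitness[where f' = "flip i"]) (auto intro: flip_in_cube)

lemma sum_cube_flip: "i < n \<Longrightarrow> (\<Sum>x\<in>cube n. F (flip i x)) = (\<Sum>x\<in>cube n. F x)"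
  by (rule sum.reindex_bij_betw[OF bij_betw_flip])

lemma sum_cube_flip_antisym:
  fixes F :: "(nat \<Rightarrow> real) \<Rightarrow> real"
  assumes "i < n" "\<And>x. x \<in> cube n \<Longrightarrow> F (flip i x) = - F x"
  shows "(\<Sum>x\<in>cube n. F x) = 0"
proof -
  have "(\<Sum>x\<in>cube n. F x) = (\<Sum>x\<in>cube n. - F x)"
    using sum_cube_flip[OF assms(1), of F] assms(2) by simp
  then show ?thesis by (simp add: sum_negf)
qed

section \<open>Points of the cube as subsets\<close>

text \<open>Identifying a point with the set of its coordinates equal to 1 turns counting points
  into counting subsets, where binomial coefficients are available.\<close>

definition ones :: "nat \<Rightarrow> (nat \<Rightarrow> real) \<Rightarrow> nat set" where
  "ones n x = {j. j < n \<and> x j = 1}"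

lemma bij_betw_ones: "bij_betw (ones n) (cube n) (Pow {..<n})"
proof (rule bij_betw_byWitness[where f' = "\<lambda>A. \<lambda>j\<in>{..<n}. if j \<in> A then 1 else -1"])
  show "\<forall>x\<in>cube n. (\<lambda>j\<in>{..<n}. if j \<in> ones n x then 1 else -1) = x"
    by (auto simp: ones_def fun_eq_iff cube_def PiE_def Pi_def extensional_def)
qed (auto simp: ones_def cube_def split: if_splits)

lemma card_cube_ones:
  "card {x \<in> cube n. P (ones n x)} = card {A. A \<subseteq> {..<n} \<and> P A}"
proof -
  have "ones n ` {x \<in> cube n. P (ones n x)} = {A \<in> Pow {..<n}. P A}"
    unfolding bij_betw_imp_surj_on[OF bij_betw_ones, symmetric] by blast
  then have "bij_betw (ones n) {x \<in> cube n. P (ones n x)} {A. A \<subseteq> {..<n} \<and> P A}"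
    by (intro bij_betw_subset[OF bij_betw_ones]) auto
  then show ?thesis by (rule bij_betw_same_card)
qed

lemma bij_betw_Un_interval_sets:
  assumes "C \<subseteq> D"
  shows "bij_betw (\<lambda>B. B \<union> C) (Pow (D - C)) {A. C \<subseteq> A \<and> A \<subseteq> D}"
  by (rule bij_betw_byWitness[where f' = "\<lambda>A. A - C"]) (use assms in auto)

lemma card_interval_sets:
  assumes "C \<subseteq> D" "finite D"
  shows "card {A. C \<subseteq> A \<and> A \<subseteq> D} = 2 ^ (card D - card C)"
  using bij_betw_same_card[OF bij_betw_Un_interval_sets[OF assms(1)]] assms
  by (simp add: card_Pow card_Diff_subset finite_subset)

text \<open>Removing \<open>C\<close> is a bijection onto the \<open>r\<close>-element subsets of
  \<open>D - C\<close>.\<close>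

lemma card_interval_sets_of_card:
  assumes "C \<subseteq> D" "finite D"
  shows "card {A. C \<subseteq> A \<and> A \<subseteq> D \<and> card A = card C + r} = (card D - card C) choose r"
proof -
  have fin: "finite C" using assms finite_subset by blast
  have card_Un: "card (B \<union> C) = card B + card C" if "B \<subseteq> D - C" for B
    using that assms fin by (intro card_Un_disjoint) (auto intro: finite_subset)
  have "bij_betw (\<lambda>B. B \<union> C) {B. B \<subseteq> D - C \<and> card B = r}
      {A. C \<subseteq> A \<and> A \<subseteq> D \<and> card A = card C + r}"
  proof (rule bij_betw_byWitness[where f' = "\<lambda>A. A - C"])
    show "(\<lambda>B. B \<union> C) ` {B. B \<subseteq> D - C \<and> card B = r}
        \<subseteq> {A. C \<subseteq> A \<and> A \<subseteq> D \<and> card A = card C + r}"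
      using card_Un assms by auto
    show "(\<lambda>A. A - C) ` {A. C \<subseteq> A \<and> A \<subseteq> D \<and> card A = card C + r}
        \<subseteq> {B. B \<subseteq> D - C \<and> card B = r}"
      using fin by (auto simp: card_Diff_subset)
  qed auto
  from bij_betw_same_card[OF this] show ?thesis
    using assms fin by (simp add: n_subsets card_Diff_subset)
qed

lemma ones_flip:
  assumes "i < n" "x \<in> cube n"
  shows "ones n (flip i x) = (if i \<in> ones n x then ones n x - {i} else insert i (ones n x))"
  using assms cube_values[of x n i] by (auto simp: ones_def flip_def)

lemma finite_ones [simp]: "finite (ones n x)"
  by (simp add: ones_def)

text \<open>\<open>flip i\<close> exchanges the halves \<open>x i = 1\<close> and
  \<open>x i = -1\<close> of a flip-invariant set. Pivotal points of coordinate \<open>i\<close>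
  form such a set, so they need only be counted where \<open>x i = 1\<close>.\<close>

lemma card_cube_half:
  fixes P :: "(nat \<Rightarrow> real) \<Rightarrow> bool"
  assumes i: "i < n" and P: "\<And>x. x \<in> cube n \<Longrightarrow> P (flip i x) = P x"
  shows "card {x \<in> cube n. P x} = 2 * card {x \<in> cube n. P x \<and> x i = 1}"
proof -
  let ?A = "{x \<in> cube n. P x \<and> x i = 1}" and ?B = "{x \<in> cube n. P x \<and> x i = -1}"
  have "bij_betw (flip i) ?A ?B"
    by (rule bij_betw_byWitness[where f' = "flip i"])
      (use i P in \<open>auto intro: flip_in_cube simp: flip_apply\<close>)
  then have "card ?A = card ?B" by (rule bij_betw_same_card)
  moreover have "{x \<in> cube n. P x} = ?A \<union> ?B" using cube_values[OF _ i] by auto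
  moreover have "card (?A \<union> ?B) = card ?A + card ?B" by (rule card_Un_disjoint) auto
  ultimately show ?thesis by simp
qed

lemma card_conjunction:
  assumes "C \<subseteq> {..<n}"
  shows "card {x \<in> cube n. \<forall>j\<in>C. x j = 1} = 2 ^ (n - card C)"
proof -
  have "{x \<in> cube n. \<forall>j\<in>C. x j = 1} = {x \<in> cube n. C \<subseteq> ones n x}"
    using assms by (auto simp: ones_def)
  then show ?thesis
    using card_cube_ones[of n "\<lambda>A. C \<subseteq> A"] card_interval_sets[OF assms]
    by (simp add: conj_commute)
qed

section \<open>Orthogonality of coordinates on subcubes\<close>

text \<open>Since \<open>i\<close> is not in \<open>C\<close>, \<open>flip i\<close> preserves the
  subcube, and the terms cancel in pairs. This gives both the orthogonality of distinct coordinates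
  and that of \<open>g\<close> to each coordinate it ignores.\<close>

lemma sum_subcube_flip_antisym:
  fixes F :: "(nat \<Rightarrow> real) \<Rightarrow> real"
  assumes "i < n" "i \<notin> C" "\<And>x. x \<in> cube n \<Longrightarrow> F (flip i x) = - F x"
  shows "(\<Sum>x | x \<in> cube n \<and> (\<forall>j\<in>C. x j = 1). F x) = 0"
proof -
  have "(\<forall>j\<in>C. flip i x j = 1) = (\<forall>j\<in>C. x j = 1)" for x
    using assms(2) by (auto simp: flip_def)
  then show ?thesis
    unfolding sum.inter_filter[OF finite_cube]
    by (intro sum_cube_flip_antisym[OF assms(1)]) (use assms(3) in auto)
qed

text \<open>After expanding the square, the mixed products vanish by orthogonality and each diagonal
  term is 1 at every point of the subcube.\<close>

lemma sum_square_linear_subcube: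
  assumes "finite T" "T \<subseteq> {..<n}" "C \<subseteq> {..<n}" "T \<inter> C = {}"
  shows "(\<Sum>x | x \<in> cube n \<and> (\<forall>j\<in>C. x j = 1). (\<Sum>i\<in>T. x i)\<^sup>2) = real (card T) * 2 ^ (n - card C)"
proof -
  let ?A = "{x. x \<in> cube n \<and> (\<forall>j\<in>C. x j = 1)}"
  have inner: "(\<Sum>x\<in>?A. x i * x l) = (if i = l then 2 ^ (n - card C) else 0)"
    if "i \<in> T" "l \<in> T" for i l
  proof (cases "i = l")
    case True
    have "l < n" using that(2) assms(2) by auto
    have "(\<Sum>x\<in>?A. x i * x l) = (\<Sum>x\<in>?A. 1)"
    proof (rule sum.cong)
      fix x assume "x \<in> ?A"
      then show "x i * x l = 1"
        using True cube_values[of x n l] \<open>l < n\<close> by auto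
    qed simp
    then show ?thesis using True card_conjunction[OF assms(3)] by simp
  next
    case False
    have "(\<Sum>x\<in>?A. x i * x l) = 0"
      by (rule sum_subcube_flip_antisym[of i]) (use that assms False in \<open>auto simp: flip_def\<close>)
    then show ?thesis using False by simp
  qed
  have "(\<Sum>x\<in>?A. (\<Sum>i\<in>T. x i)\<^sup>2) = (\<Sum>x\<in>?A. \<Sum>i\<in>T. \<Sum>l\<in>T. x i * x l)"
    by (simp add: power2_eq_square sum_product)
  also have "\<dots> = (\<Sum>i\<in>T. \<Sum>x\<in>?A. \<Sum>l\<in>T. x i * x l)" by (rule sum.swap)
  also have "\<dots> = (\<Sum>i\<in>T. \<Sum>l\<in>T. \<Sum>x\<in>?A. x i * x l)"
    by (intro sum.cong refl sum.swap)
  also have "\<dots> = (\<Sum>i\<in>T. \<Sum>l\<in>T. if i = l then 2 ^ (n - card C) else 0)"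
    by (intro sum.cong refl) (simp add: inner)
  also have "\<dots> = real (card T) * 2 ^ (n - card C)"
    using assms(1) by simp
  finally show ?thesis .
qed

section \<open>The central binomial coefficient\<close>

text \<open>The absorption identity for the binomial coefficient has the factor
  \<open>2 * Suc h\<close> on one side and \<open>Suc h\<close> on the other; cancelling leaves the
  2.\<close>

lemma central_binomial_Suc_half:
  "2 * Suc h choose Suc h = 2 * (2 * h + 1 choose h)"
proof -
  have "Suc h * (2 * Suc h choose Suc h) = Suc h * (2 * (2 * h + 1 choose h))"
  proof -
    have "Suc (2 * h + 1) = 2 * Suc h" by simp
    then show ?thesis
      using Suc_times_binomial[of h "2 * h + 1"] by (metis mult.assoc mult.commute)
  qed
  then show ?thesis by (simp only: mult_left_cancel)
qed

lemma central_binomial_Suc: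
  "Suc h * (2 * Suc h choose Suc h) = 2 * (2 * h + 1) * (2 * h choose h)"
proof -
  have "Suc h * (2 * h + 1 choose h) = (2 * h + 1) * (2 * h choose h)"
    using Suc_times_binomial_add[of h h] Suc_times_binomial[of h "2 * h"]
      binomial_symmetric[of h "2 * h + 1"] by (simp add: mult_2)
  then show ?thesis unfolding central_binomial_Suc_half by (metis mult.assoc mult.left_commute)
qed

text \<open>With \<open>c h\<close> the central binomial coefficient,
  \<open>(2h+1) * c h ^ 2 / 16 ^ h\<close> is nonincreasing and starts at 1, while
  \<open>4h * c h ^ 2 / 16 ^ h\<close> is nondecreasing and equals 1 at \<open>h = 1\<close>. The
  squared recurrence avoids square roots.\<close>

lemma central_binomial_sq_bounds:
  "real (2 * h + 1) * real (2 * h choose h) ^ 2 \<le> 16 ^ h"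
  "h \<ge> 1 \<Longrightarrow> 16 ^ h \<le> 4 * real h * real (2 * h choose h) ^ 2"
proof -
  define c where "c h = real (2 * h choose h)" for h
  have rec: "(real h + 1)\<^sup>2 * c (Suc h) ^ 2 = 4 * (2 * real h + 1)\<^sup>2 * c h ^ 2" for h
  proof -
    have "(real h + 1) * c (Suc h) = 2 * (2 * real h + 1) * c h"
      using arg_cong[OF central_binomial_Suc[of h], of real] by (simp add: c_def algebra_simps)
    then have "((real h + 1) * c (Suc h))\<^sup>2 = (2 * (2 * real h + 1) * c h)\<^sup>2" by simp
    then show ?thesis unfolding power_mult_distrib by simp
  qed
  have "(2 * real h + 1) * c h ^ 2 \<le> 16 ^ h"
  proof (induction h)
    case (Suc h)
    have "(real h + 1)\<^sup>2 * ((2 * real h + 3) * c (Suc h) ^ 2)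
        = (2 * real h + 3) * ((real h + 1)\<^sup>2 * c (Suc h) ^ 2)"
      by (simp only: mult_ac)
    also have "\<dots> = 4 * (2 * real h + 3) * (2 * real h + 1) * ((2 * real h + 1) * c h ^ 2)"
      unfolding rec by (simp add: power2_eq_square mult_ac)
    also have "\<dots> \<le> 4 * (2 * real h + 3) * (2 * real h + 1) * 16 ^ h"
      using Suc by (intro mult_left_mono) auto
    \<comment> \<open>Here (2h+3)(2h+1) = (2h+2)^2 - 1.\<close>
    also have "\<dots> \<le> (16 * (real h + 1)\<^sup>2) * 16 ^ h"
      by (intro mult_right_mono) (auto simp: power2_eq_square algebra_simps)
    finally have "(real h + 1)\<^sup>2 * ((2 * real h + 3) * c (Suc h) ^ 2) \<le> (real h + 1)\<^sup>2 * 16 ^ Suc h"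
      by simp
    then have "(2 * real h + 3) * c (Suc h) ^ 2 \<le> 16 ^ Suc h"
      by (rule mult_left_le_imp_le) simp
    then show ?case by (simp add: algebra_simps)
  qed (simp add: c_def)
  then show "real (2 * h + 1) * real (2 * h choose h) ^ 2 \<le> 16 ^ h"
    by (simp add: c_def add.commute)
  assume "h \<ge> 1"
  then have "16 ^ h \<le> 4 * real h * c h ^ 2"
  proof (induction h rule: dec_induct)
    case base
    show ?case by (simp add: c_def)
  next
    case (step h)
    have "(real h + 1) * 16 ^ Suc h = 16 * (real h + 1) * 16 ^ h" by simp
    also have "\<dots> \<le> 16 * (real h + 1) * (4 * real h * c h ^ 2)"
      by (intro mult_left_mono step.IH) simp
    also have "\<dots> = 16 * (4 * real h * (real h + 1)) * c h ^ 2"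
      by (simp only: mult_ac)
    \<comment> \<open>Here 4h(h+1) = (2h+1)^2 - 1.\<close>
    also have "\<dots> \<le> 16 * (2 * real h + 1)\<^sup>2 * c h ^ 2"
      by (intro mult_right_mono mult_left_mono) (auto simp: power2_eq_square algebra_simps)
    also have "\<dots> = 4 * ((real h + 1)\<^sup>2 * c (Suc h) ^ 2)"
      unfolding rec by simp
    also have "\<dots> = (real h + 1) * (4 * (real h + 1) * c (Suc h) ^ 2)"
      by (simp add: power2_eq_square mult_ac)
    finally have "16 ^ Suc h \<le> 4 * (real h + 1) * c (Suc h) ^ 2"
      by (rule mult_left_le_imp_le) simp
    then show ?case by (simp add: algebra_simps)
  qed
  then show "16 ^ h \<le> 4 * real h * real (2 * h choose h) ^ 2"
    by (simp add: c_def)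
qed

section \<open>Conjunction with a majority\<close>

text \<open>The majority bits come first and the \<open>k\<close> conjunction bits last. The number
  of majority bits is even, and a tie counts as a majority, in agreement with
  \<open>sign_ge0\<close>.\<close>

definition and_majority :: "nat \<Rightarrow> nat \<Rightarrow> (nat \<Rightarrow> real) \<Rightarrow> real" where
  "and_majority h k x =
     (if (\<forall>j\<in>{2*h..<2*h+k}. x j = 1) \<and> 0 \<le> (\<Sum>i<2*h. x i) then 1 else -1)"

text \<open>Each conjunction bit gets weight \<open>m = 2 * h\<close>, and the threshold is
  \<open>m * k\<close>. One failed conjunct costs at least \<open>2 * m\<close>, more than the
  majority sum, at most \<open>m\<close>, can restore.\<close>

lemma and_majority_threshold:
  assumes "h \<ge> 1"
  shows "threshold_function (2 * h + k) (and_majority h k)"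
proof -
  define m where "m = 2 * h"
  define w where "w i = (if i < m then 1 else real m)" for i
  have "and_majority h k x = sign_ge0 ((\<Sum>i<m+k. w i * x i) - real m * real k)"
    if x: "x \<in> cube (m + k)" for x
  proof -
    have val: "x i = 1 \<or> x i = -1" if "i < m + k" for i
      using cube_values[OF x that] .
    have "(\<Sum>i<m+k. w i * x i) = (\<Sum>i<m. w i * x i) + (\<Sum>i\<in>{m..<m+k}. w i * x i)"
      by (subst sum.union_disjoint[symmetric]) (auto intro: sum.cong)
    also have "\<dots> = (\<Sum>i<m. x i) + real m * (\<Sum>i\<in>{m..<m+k}. x i)"
      by (simp add: w_def sum_distrib_left)
    finally have eq: "(\<Sum>i<m+k. w i * x i) - real m * real k
        = (\<Sum>i<m. x i) + real m * ((\<Sum>i\<in>{m..<m+k}. x i) - real k)"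
      by (simp add: algebra_simps)
    show ?thesis
    proof (cases "\<forall>j\<in>{m..<m+k}. x j = 1")
      case True
      then have "(\<Sum>i\<in>{m..<m+k}. x i) = real k" by simp
      with True eq show ?thesis by (simp add: and_majority_def sign_ge0_def m_def)
    next
      case False
      then obtain j where j: "j \<in> {m..<m+k}" "x j \<noteq> 1" by blast
      then have xj: "x j = -1" using val by auto
      have le1: "x i \<le> 1" if "i < m + k" for i using val[OF that] by auto
      have "(\<Sum>i\<in>{m..<m+k}. x i) = x j + (\<Sum>i\<in>{m..<m+k}-{j}. x i)"
        using j by (simp add: sum.remove)
      also have "\<dots> \<le> -1 + (\<Sum>i\<in>{m..<m+k}-{j}. 1)"
        unfolding xj by (intro add_left_mono sum_mono) (auto intro: le1)
      also have "\<dots> = real k - 2" using j by (simp add: card_Diff_singleton of_nat_diff)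
      finally have "(\<Sum>i\<in>{m..<m+k}. x i) - real k \<le> -2" by simp
      then have "real m * ((\<Sum>i\<in>{m..<m+k}. x i) - real k) \<le> real m * (-2)"
        by (intro mult_left_mono) auto
      moreover have "(\<Sum>i<m. x i) \<le> (\<Sum>i<m. 1)"
        by (intro sum_mono) (auto intro: le1)
      \<comment> \<open>The sum is at most \<open>-m\<close>; it must be strictly negative because
        \<open>sign_ge0\<close> is 1 at 0.\<close>
      moreover have "m > 0" using assms by (simp add: m_def)
      ultimately have "(\<Sum>i<m+k. w i * x i) - real m * real k < 0" using eq by simp
      then show ?thesis using False by (auto simp: and_majority_def sign_ge0_def m_def)
    qed
  qed
  then show ?thesis unfolding threshold_function_def m_def by blast
qed

text \<open>Once all \<open>k\<close> conjunction bits are 1, having at least \<open>h\<close> ones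
  among the majority bits amounts to having at least \<open>h + k\<close> ones in total.\<close>

lemma and_majority_ones:
  assumes x: "x \<in> cube (2 * h + k)"
  shows "and_majority h k x =
    (if {2*h..<2*h+k} \<subseteq> ones (2*h+k) x \<and> h + k \<le> card (ones (2*h+k) x) then 1 else -1)"
proof -
  let ?O = "ones (2*h+k) x"
  have conj: "(\<forall>j\<in>{2*h..<2*h+k}. x j = 1) \<longleftrightarrow> {2*h..<2*h+k} \<subseteq> ?O"
    by (auto simp: ones_def)
  have "(\<Sum>i<2*h. x i) = (\<Sum>i<2*h. (if i \<in> ?O then 2 else 0) - 1)"
  proof (rule sum.cong)
    fix i assume "i \<in> {..<2*h}"
    then show "x i = (if i \<in> ?O then 2 else 0) - 1"
      using cube_values[OF x, of i] by (auto simp: ones_def)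
  qed simp
  also have "\<dots> = 2 * real (card (?O \<inter> {..<2*h})) - real (2 * h)"
    by (simp add: sum_subtractf sum.If_cases Int_commute)
  finally have sum: "(\<Sum>i<2*h. x i) = 2 * real (card (?O \<inter> {..<2*h})) - real (2 * h)" .
  have "card ?O = card (?O \<inter> {..<2*h}) + k" if "{2*h..<2*h+k} \<subseteq> ?O"
  proof -
    have "?O = (?O \<inter> {..<2*h}) \<union> {2*h..<2*h+k}"
      using that by (auto simp: ones_def)
    then have "card ?O = card ((?O \<inter> {..<2*h}) \<union> {2*h..<2*h+k})" by simp
    also have "\<dots> = card (?O \<inter> {..<2*h}) + card {2*h..<2*h+k}"
      by (rule card_Un_disjoint) auto
    finally show ?thesis by simp
  qed
  then show ?thesis unfolding and_majority_def conj sum by auto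
qed

text \<open>Flipping \<open>i\<close> removes one element from the set of ones and leaves the
  conjunction bits alone. The value therefore changes only at the exact level \<open>h + k\<close>,
  and only downwards.\<close>

lemma and_majority_pivotal:
  assumes i: "i < 2 * h" and x: "x \<in> cube (2 * h + k)" and xi: "x i = 1"
  shows "and_majority h k x \<noteq> and_majority h k (flip i x) \<longleftrightarrow>
    insert i {2*h..<2*h+k} \<subseteq> ones (2*h+k) x \<and> card (ones (2*h+k) x) = h + k"
    and "and_majority h k (flip i x) \<le> and_majority h k x"
proof -
  let ?O = "ones (2*h+k) x"
  have iO: "i \<in> ?O" using i xi by (simp add: ones_def)
  then have card: "card (?O - {i}) = card ?O - 1" "card ?O \<ge> 1"
    by (auto simp: Suc_le_eq card_gt_0_iff)
  have i': "i < 2 * h + k" "i \<notin> {2*h..<2*h+k}" using i by auto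
  then have "ones (2*h+k) (flip i x) = ?O - {i}"
    using ones_flip[OF i'(1) x] iO by simp
  note f = and_majority_ones[OF x] and_majority_ones[OF flip_in_cube[OF x i'(1)]] this
  have sub: "{2*h..<2*h+k} \<subseteq> ?O - {i} \<longleftrightarrow> {2*h..<2*h+k} \<subseteq> ?O" using i'(2) by blast
  show "and_majority h k x \<noteq> and_majority h k (flip i x) \<longleftrightarrow>
    insert i {2*h..<2*h+k} \<subseteq> ?O \<and> card ?O = h + k"
    unfolding f sub card(1) using iO card(2) by auto
  show "and_majority h k (flip i x) \<le> and_majority h k x"
    unfolding f sub card(1) by auto
qed

section \<open>Influences of the two kinds of bits\<close>

text \<open>Where \<open>x i = 1\<close>, the set of ones at a pivotal point contains
  \<open>i\<close> and the conjunction bits, plus \<open>h - 1\<close> of the other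
  \<open>2 * h - 1\<close> majority bits. Doubling gives the central binomial coefficient.\<close>

lemma card_and_majority_pivotal:
  assumes i: "i < 2 * h"
  shows "card {x \<in> cube (2*h+k). and_majority h k x \<noteq> and_majority h k (flip i x)} = 2 * h choose h"
proof -
  let ?n = "2 * h + k"
  have h: "h \<ge> 1" using i by simp
  let ?C = "insert i {2*h..<2*h+k}"
  have cardC: "card ?C = k + 1" using i by simp
  have "card {x \<in> cube ?n. and_majority h k x \<noteq> and_majority h k (flip i x)}
      = 2 * card {x \<in> cube ?n. and_majority h k x \<noteq> and_majority h k (flip i x) \<and> x i = 1}"
    by (rule card_cube_half) (use i in auto)
  also have "{x \<in> cube ?n. and_majority h k x \<noteq> and_majority h k (flip i x) \<and> x i = 1}
      = {x \<in> cube ?n. ?C \<subseteq> ones ?n x \<and> card (ones ?n x) = h + k}"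
    using and_majority_pivotal(1)[OF i] by (auto simp: ones_def)
  also have "card \<dots> = card {A. A \<subseteq> {..<?n} \<and> ?C \<subseteq> A \<and> card A = h + k}"
    by (rule card_cube_ones)
  also have "{A. A \<subseteq> {..<?n} \<and> ?C \<subseteq> A \<and> card A = h + k}
      = {A. ?C \<subseteq> A \<and> A \<subseteq> {..<?n} \<and> card A = card ?C + (h - 1)}"
    unfolding cardC using h by auto
  also have "card \<dots> = (2 * h - 1 choose (h - 1))"
    by (subst card_interval_sets_of_card) (use i cardC in auto)
  also have "2 * \<dots> = 2 * h choose h"
    using h central_binomial_Suc_half[of "h - 1"] by (cases h) (auto simp del: binomial_Suc_Suc)
  finally show ?thesis .
qed

text \<open>A flip of one conjunct matters only if the other \<open>k - 1\<close> conjuncts hold.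
  Ignoring the majority condition is affordable, since these bounds add up to
  \<open>2 * k / 2 ^ k\<close>.\<close>

lemma influence_conjunct_le:
  assumes i: "i \<in> {2*h..<2*h+k}"
  shows "influence (2*h+k) i (and_majority h k) \<le> 2 / 2 ^ k"
proof -
  let ?n = "2 * h + k" and ?C = "{2*h..<2*h+k} - {i}"
  have "{x \<in> cube ?n. and_majority h k x \<noteq> and_majority h k (flip i x)}
      \<subseteq> {x \<in> cube ?n. \<forall>j\<in>?C. x j = 1}"
    by (auto simp: and_majority_def flip_def split: if_splits)
  then have "card {x \<in> cube ?n. and_majority h k x \<noteq> and_majority h k (flip i x)}
      \<le> card {x \<in> cube ?n. \<forall>j\<in>?C. x j = 1}"
    by (intro card_mono) auto
  also have "\<dots> = 2 ^ (?n - card ?C)" by (rule card_conjunction) auto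
  also have "?n - card ?C = 2 * h + 1" using i by auto
  finally have "real (card {x \<in> cube ?n. and_majority h k x \<noteq> and_majority h k (flip i x)})
      \<le> real (2 ^ (2 * h + 1))"
    by (rule of_nat_mono)
  then show ?thesis
    by (simp add: influence_def cube_prob_eq field_simps power_add)
qed

text \<open>\<open>M h k\<close> is the exact contribution of the majority bits; the conjunction
  bits are only estimated.\<close>

lemma total_influence_and_majority:
  defines "M h k \<equiv> real (2 * h) * real (2 * h choose h) / 2 ^ (2 * h + k)"
  shows "M h k \<le> total_influence (2*h+k) (and_majority h k)"
    and "total_influence (2*h+k) (and_majority h k) \<le> M h k + 2 * real k / 2 ^ k"
proof -
  let ?I = "\<lambda>i. influence (2*h+k) i (and_majority h k)"
  have "total_influence (2*h+k) (and_majority h k) = (\<Sum>i<2*h. ?I i) + (\<Sum>i\<in>{2*h..<2*h+k}. ?I i)"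
    unfolding total_influence_def
    by (subst sum.union_disjoint[symmetric]) (auto intro: sum.cong)
  moreover have "(\<Sum>i<2*h. ?I i) = M h k"
    by (simp add: influence_def cube_prob_eq card_and_majority_pivotal M_def)
  moreover have "(\<Sum>i\<in>{2*h..<2*h+k}. ?I i) \<ge> 0"
    by (intro sum_nonneg) (simp add: influence_def cube_prob_eq)
  moreover have "(\<Sum>i\<in>{2*h..<2*h+k}. ?I i) \<le> (\<Sum>i\<in>{2*h..<2*h+k}. 2 / 2 ^ k)"
    by (intro sum_mono influence_conjunct_le)
  ultimately show "M h k \<le> total_influence (2*h+k) (and_majority h k)"
    and "total_influence (2*h+k) (and_majority h k) \<le> M h k + 2 * real k / 2 ^ k"
    by (auto simp: mult.commute)
qed

section \<open>Approximation by functions of few variables\<close>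

text \<open>Pair \<open>x\<close> with \<open>flip i x\<close>. By monotonicity in \<open>i\<close>,
  a pivotal pair contributes 2 and any other pair 0, so the sum equals the number of pivotal
  points.\<close>

lemma sum_and_majority_coordinate:
  assumes i: "i < 2 * h"
  shows "(\<Sum>x | x \<in> cube (2*h+k) \<and> (\<forall>j\<in>{2*h..<2*h+k}. x j = 1). and_majority h k x * x i)
    = real (2 * h choose h)"
proof -
  let ?n = "2 * h + k" and ?A = "\<lambda>x. \<forall>j\<in>{2*h..<2*h+k}. x j = (1::real)"
  let ?f = "and_majority h k"
  let ?F = "\<lambda>x. if ?A x then ?f x * x i else 0"
  have i': "i < ?n" using i by simp
  have A: "?A (flip i x) = ?A x" for x using i by (auto simp: flip_def)
  have pt: "?F x + ?F (flip i x) = 2 * (if ?f x \<noteq> ?f (flip i x) then 1 else 0)"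
    if x: "x \<in> cube ?n" for x
  proof -
    have "?f y - ?f (flip i y) = 2 * (if ?f y \<noteq> ?f (flip i y) then 1 else 0)"
      if "y \<in> cube ?n" "y i = 1" for y
      using and_majority_pivotal(2)[OF i that] by (auto simp: and_majority_def split: if_splits)
    from this[OF x] this[OF flip_in_cube[OF x i']]
    have "(?f x - ?f (flip i x)) * x i = 2 * (if ?f x \<noteq> ?f (flip i x) then 1 else 0)"
      using cube_values[OF x i'] by (auto simp: flip_apply)
    \<comment> \<open>Off the subcube both values are -1, so restricting to it loses no pivotal
      point.\<close>
    moreover have "?f x = ?f (flip i x)" if "\<not> ?A x"
      using that A[of x] by (auto simp: and_majority_def)
    ultimately show ?thesis
      unfolding A by (auto simp: flip_apply algebra_simps)
  qed
  have "2 * (\<Sum>x\<in>cube ?n. ?F x) = (\<Sum>x\<in>cube ?n. ?F x) + (\<Sum>x\<in>cube ?n. ?F (flip i x))"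
    unfolding sum_cube_flip[OF i', of ?F] by simp
  also have "\<dots> = (\<Sum>x\<in>cube ?n. 2 * (if ?f x \<noteq> ?f (flip i x) then 1 else 0))"
    by (simp only: sum.distrib[symmetric] pt cong: sum.cong)
  also have "\<dots> = 2 * real (card {x \<in> cube ?n. ?f x \<noteq> ?f (flip i x)})"
    by (simp add: sum_distrib_left[symmetric] sum.If_cases Int_def)
  finally have "(\<Sum>x\<in>cube ?n. ?F x) = real (2 * h choose h)"
    using card_and_majority_pivotal[OF i] by simp
  moreover have "(\<Sum>x | x \<in> cube ?n \<and> ?A x. ?f x * x i) = (\<Sum>x\<in>cube ?n. ?F x)"
    by (rule sum.inter_filter) simp
  ultimately show ?thesis by simp
qed

text \<open>Restricting to \<open>?A\<close> keeps the correlation at \<open>t * c\<close> but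
  leaves a second moment of only \<open>t * 2 ^ (2 * h)\<close> for the linear form. Of the constant
  16, one factor 4 is the value of \<open>(f - g)^2\<close> at a disagreement, the other comes from
  the lower bound on \<open>c\<close>.\<close>

lemma irrelevant_majority_bits:
  assumes h: "h \<ge> 1" and g: "g \<in> cube (2*h+k) \<rightarrow> {-1, 1}"
    and close: "cube_prob (2*h+k) (\<lambda>x. and_majority h k x \<noteq> g x) \<le> \<epsilon>"
  shows "real (card ({..<2*h} - relevant_variables (2*h+k) g)) \<le> 16 * \<epsilon> * 2 ^ k * real h"
proof -
  let ?n = "2 * h + k" and ?f = "and_majority h k"
  define T where "T = {..<2*h} - relevant_variables ?n g"
  define t where "t = real (card T)"
  define c where "c = real (2 * h choose h)"
  let ?A = "{x. x \<in> cube ?n \<and> (\<forall>j\<in>{2*h..<2*h+k}. x j = 1)}"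
  have T: "finite T" "T \<subseteq> {..<2*h}" by (auto simp: T_def)
  have cpos: "c > 0" by (simp add: c_def)
  have ortho: "(\<Sum>x\<in>?A. g x * x i) = 0" if "i \<in> T" for i
    by (rule sum_subcube_flip_antisym[of i])
      (use that in \<open>auto simp: T_def relevant_variables_def flip_apply\<close>)
  have "(\<Sum>x\<in>?A. (?f x - g x) * (\<Sum>i\<in>T. x i)) = (\<Sum>i\<in>T. \<Sum>x\<in>?A. (?f x - g x) * x i)"
    unfolding sum_distrib_left by (rule sum.swap)
  also have "\<dots> = (\<Sum>i\<in>T. c)"
  proof (rule sum.cong)
    fix i assume "i \<in> T"
    then show "(\<Sum>x\<in>?A. (?f x - g x) * x i) = c"
      using sum_and_majority_coordinate[of i h k] ortho[of i] T
      by (auto simp: left_diff_distrib sum_subtractf c_def)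
  qed simp
  finally have corr: "(\<Sum>x\<in>?A. (?f x - g x) * (\<Sum>i\<in>T. x i)) = t * c"
    by (simp add: t_def)
  \<comment> \<open>Closeness is known only on the whole cube, so all disagreements are charged to
    \<open>?A\<close>.\<close>
  have "(\<Sum>x\<in>?A. (?f x - g x)\<^sup>2) \<le> (\<Sum>x\<in>cube ?n. (?f x - g x)\<^sup>2)"
    by (rule sum_mono2) auto
  also have "\<dots> = (\<Sum>x\<in>cube ?n. if ?f x \<noteq> g x then 4 else 0)"
  proof (rule sum.cong)
    fix x assume "x \<in> cube ?n"
    then have "g x = -1 \<or> g x = 1" using g by auto
    then show "(?f x - g x)\<^sup>2 = (if ?f x \<noteq> g x then 4 else 0)"
      by (auto simp: and_majority_def)
  qed simp
  also have "\<dots> = 4 * real (card {x \<in> cube ?n. ?f x \<noteq> g x})"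
    by (simp add: sum.If_cases Int_def)
  also have "\<dots> \<le> 4 * (\<epsilon> * 2 ^ ?n)"
    using close by (simp add: cube_prob_eq field_simps)
  finally have err: "(\<Sum>x\<in>?A. (?f x - g x)\<^sup>2) \<le> 4 * (\<epsilon> * 2 ^ ?n)" .
  have "T \<subseteq> {..<?n}" "{2*h..<2*h+k} \<subseteq> {..<?n}" "T \<inter> {2*h..<2*h+k} = {}"
    using T(2) by auto
  from sum_square_linear_subcube[OF T(1) this]
  have sq: "(\<Sum>x\<in>?A. (\<Sum>i\<in>T. x i)\<^sup>2) = t * 2 ^ (2 * h)"
    by (simp add: t_def)
  have pow16: "2 ^ (2 * h) * 2 ^ (2 * h) = (16::real) ^ h"
    by (simp add: power_mult power_mult_distrib[symmetric])
  have "(t * c)\<^sup>2 \<le> (\<Sum>x\<in>?A. (?f x - g x)\<^sup>2) * (\<Sum>x\<in>?A. (\<Sum>i\<in>T. x i)\<^sup>2)"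
    unfolding corr[symmetric] by (rule Cauchy_Schwarz_ineq_sum)
  also have "\<dots> \<le> 4 * (\<epsilon> * 2 ^ ?n) * (t * 2 ^ (2 * h))"
    unfolding sq using err by (intro mult_right_mono) (auto simp: t_def)
  also have "\<dots> = 4 * \<epsilon> * 2 ^ k * t * 16 ^ h"
    using pow16 by (simp add: power_add mult_ac)
  finally have le: "t * (t * c\<^sup>2) \<le> t * (4 * \<epsilon> * 2 ^ k * 16 ^ h)"
    by (simp add: power2_eq_square mult_ac)
  have eps: "\<epsilon> \<ge> 0" using close by (rule order_trans[rotated]) (simp add: cube_prob_eq)
  show ?thesis
  \<comment> \<open>Both sides of \<open>le\<close> carry a factor \<open>t\<close>, which can be
    cancelled only when it is nonzero.\<close>
  proof (cases "t = 0")
    case True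
    show ?thesis unfolding T_def[symmetric] t_def[symmetric] True using eps by simp
  next
    case False
    then have "t * c\<^sup>2 \<le> 4 * \<epsilon> * 2 ^ k * 16 ^ h"
      using le by (intro mult_left_le_imp_le[OF le]) (simp add: t_def)
    also have "\<dots> \<le> 4 * \<epsilon> * 2 ^ k * (4 * real h * c\<^sup>2)"
      using central_binomial_sq_bounds(2)[OF h] eps
      unfolding c_def by (intro mult_left_mono) auto
    finally have "t * c\<^sup>2 \<le> (16 * \<epsilon> * 2 ^ k * real h) * c\<^sup>2" by (simp add: mult_ac)
    then have "t \<le> 16 * \<epsilon> * 2 ^ k * real h"
      by (rule mult_right_le_imp_le) (use cpos in simp)
    then show ?thesis unfolding t_def T_def .
  qed
qed

section \<open>Choice of the parameters\<close>

lemma dyadic_scale: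
  fixes y :: real
  assumes "y > 2"
  obtains k :: nat where "k \<ge> 1" "2 ^ k \<le> y" "y < 2 * 2 ^ k"
proof -
  define l where "l = \<lfloor>log 2 y\<rfloor>"
  define k where "k = nat l"
  have "log 2 y > 1" using assms by simp
  then have "l \<ge> 1" by (simp add: l_def le_floor_iff)
  then have k: "real k = of_int l" "k \<ge> 1" by (simp_all add: k_def)
  have "real k \<le> log 2 y" "log 2 y < real (Suc k)"
    using k(1) by (simp_all add: l_def) linarith
  then have "2 powr real k \<le> y" "y < 2 powr real (Suc k)"
    using assms by (simp_all add: le_log_iff log_less_iff)
  then show ?thesis using k(2) by (intro that[of k]) (simp_all add: powr_realpow powr_add)
qed

theorem proposition14:
  shows "\<exists>c1 c2 c3 \<epsilon>0 :: real. c1 > 0 \<and> c2 > 0 \<and> c3 > 0 \<and> \<epsilon>0 > 0 \<and>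
    (\<forall>\<epsilon>. 0 < \<epsilon> \<and> \<epsilon> < \<epsilon>0 \<longrightarrow>
      (\<exists>(n :: nat) (f :: (nat \<Rightarrow> real) \<Rightarrow> real). n \<ge> 1 \<and>
         f \<in> cube n \<rightarrow> {-1, 1} \<and> threshold_function n f \<and>
         c1 \<le> total_influence n f \<and> total_influence n f \<le> c2 \<and>
         (\<forall>g :: (nat \<Rightarrow> real) \<Rightarrow> real.
            g \<in> cube n \<rightarrow> {-1, 1} \<and> cube_prob n (\<lambda>x. f x \<noteq> g x) \<le> \<epsilon> \<longrightarrow>
            real (card (relevant_variables n g)) \<ge> c3 / \<epsilon>\<^sup>2)))"
\<comment> \<open>The upper bound 3 is 1 from the majority bits plus 2 from the conjunction bits;
  1/2048 is 1/(2 * 32^2); and \<epsilon> < 1/32 makes 1/(16 \<epsilon>) exceed 2, whence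
  \<open>k \<ge> 1\<close>.\<close>
proof (rule exI[of _ "1/2"], rule exI[of _ 3], rule exI[of _ "1/2048"], rule exI[of _ "1/32"],
    intro conjI allI impI)
  fix \<epsilon> :: real
  assume \<epsilon>: "0 < \<epsilon> \<and> \<epsilon> < 1/32"
  then have "1 / (16 * \<epsilon>) > 2" by (simp add: field_simps)
  from dyadic_scale[OF this] obtain k where k: "k \<ge> 1" and "2 ^ k \<le> 1 / (16 * \<epsilon>)"
    "1 / (16 * \<epsilon>) < 2 * 2 ^ k" by blast
  \<comment> \<open>\<open>le\<close> limits how many majority bits \<open>g\<close> can ignore;
    \<open>ge\<close> makes their total number at least of order 1/\<epsilon>^2.\<close>
  then have le: "16 * \<epsilon> * 2 ^ k \<le> 1" and ge: "1 < 32 * \<epsilon> * 2 ^ k"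
    using \<epsilon> by (simp_all add: field_simps)
  \<comment> \<open>This is half of \<open>4 ^ k\<close>, written without division; it uses
    \<open>k \<ge> 1\<close>.\<close>
  define h :: nat where "h = 2 * 4 ^ (k - 1)"
  have m: "2 * h = 4 ^ k" using k by (cases k) (simp_all add: h_def)
  have h: "h \<ge> 1" by (simp add: h_def)
  have mr: "2 * real h = (2 ^ k)\<^sup>2"
    using arg_cong[OF m, of real] by (simp add: power2_eq_square power_mult_distrib[symmetric])
  let ?n = "2 * h + k" and ?f = "and_majority h k"
  define M where "M = real (2 * h) * real (2 * h choose h) / 2 ^ (2 * h + k)"
  have sq4: "((4::real) ^ h)\<^sup>2 = 16 ^ h"
    by (simp add: power2_eq_square power_mult_distrib[symmetric])
  have "M = 2 ^ k * real (2 * h choose h) / 4 ^ h"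
    using mr by (simp add: M_def power_add power2_eq_square power_mult)
  \<comment> \<open>Since \<open>2 ^ k\<close> is the square root of \<open>2 * h\<close>, the
    square of \<open>M\<close> is free of \<open>k\<close>, and the two binomial bounds place it
    between 1/2 and 1.\<close>
  then have M2: "M\<^sup>2 = 2 * real h * real (2 * h choose h) ^ 2 / 16 ^ h"
    unfolding mr by (simp add: power_divide power_mult_distrib sq4)
  have M0: "M \<ge> 0" by (simp add: M_def)
  have "(1/2)\<^sup>2 \<le> (1/2 :: real)" by (simp add: power2_eq_square)
  also have "\<dots> \<le> M\<^sup>2"
    unfolding M2 using central_binomial_sq_bounds(2)[OF h] by (simp add: field_simps)
  finally have M_ge: "1/2 \<le> M" using M0 by (rule power2_le_imp_le)
  have "2 * real h * real (2 * h choose h) ^ 2 \<le> real (2 * h + 1) * real (2 * h choose h) ^ 2"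
    by (intro mult_right_mono) auto
  also note central_binomial_sq_bounds(1)
  finally have "M\<^sup>2 \<le> 1\<^sup>2" unfolding M2 by simp
  then have M_le: "M \<le> 1" by (rule power2_le_imp_le) simp
  have k2: "2 * real k / 2 ^ k \<le> 2"
    using of_nat_less_two_power[of k, where 'a = real] by (simp add: field_simps)
  show "\<exists>(n :: nat) (f :: (nat \<Rightarrow> real) \<Rightarrow> real). n \<ge> 1 \<and>
         f \<in> cube n \<rightarrow> {-1, 1} \<and> threshold_function n f \<and>
         1/2 \<le> total_influence n f \<and> total_influence n f \<le> 3 \<and>
         (\<forall>g :: (nat \<Rightarrow> real) \<Rightarrow> real.
            g \<in> cube n \<rightarrow> {-1, 1} \<and> cube_prob n (\<lambda>x. f x \<noteq> g x) \<le> \<epsilon> \<longrightarrow>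
            real (card (relevant_variables n g)) \<ge> 1/2048 / \<epsilon>\<^sup>2)"
  proof (rule exI[of _ ?n], rule exI[of _ ?f], intro conjI allI impI)
    show "?n \<ge> 1" using h by simp
    show "?f \<in> cube ?n \<rightarrow> {-1, 1}" by (auto simp: and_majority_def)
    show "threshold_function ?n ?f" by (rule and_majority_threshold[OF h])
    show "1/2 \<le> total_influence ?n ?f" "total_influence ?n ?f \<le> 3"
      using total_influence_and_majority[of h k] M_ge M_le k2 unfolding M_def by linarith+
    fix g assume g: "g \<in> cube ?n \<rightarrow> {-1, 1} \<and> cube_prob ?n (\<lambda>x. ?f x \<noteq> g x) \<le> \<epsilon>"
    let ?R = "relevant_variables ?n g"
    have "real (card ({..<2*h} - ?R)) \<le> 16 * \<epsilon> * 2 ^ k * real h"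
      using irrelevant_majority_bits[OF h] g by blast
    also have "\<dots> \<le> 1 * real h" using le by (intro mult_right_mono) auto
    finally have "card ({..<2*h} - ?R) \<le> h" by simp
    \<comment> \<open>At most \<open>h\<close> of the \<open>2 * h\<close> majority bits are
      ignored, so at least \<open>h\<close> are relevant.\<close>
    moreover have "card {..<2*h} - card ?R \<le> card ({..<2*h} - ?R)"
      by (rule diff_card_le_card_Diff) (simp add: relevant_variables_def)
    ultimately have "h \<le> card ?R" by simp
    moreover have "1/2048 / \<epsilon>\<^sup>2 \<le> real h"
    proof -
      \<comment> \<open>Squaring \<open>ge\<close> turns \<open>2 ^ k\<close> into
        \<open>2 * h\<close>, which converts the bound into one on \<open>h\<close>.\<close>
      have "1 \<le> (32 * \<epsilon> * 2 ^ k)\<^sup>2" using ge by (simp add: one_le_power)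
      also have "\<dots> = 1024 * \<epsilon>\<^sup>2 * (2 * real h)" by (simp add: power_mult_distrib mr)
      finally show ?thesis using \<epsilon> by (simp add: field_simps)
    qed
    ultimately show "real (card ?R) \<ge> 1/2048 / \<epsilon>\<^sup>2" by linarith
  qed
qed simp_all

end
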